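(* Let $X$ and $Y$ be zero-dimensional Tychonoff spaces. For any function $\varphi:\mathscr U_X\to\mathscr U_Y$, the following statements are equivalent. (1) $\varphi$ is an order-isomorphism from $(\mathscr U_X,\subseteq)$ onto $(\mathscr U_Y,\subseteq)$. (2) There is a homeomorphism $f:X\to Y$ such that $\varphi$ is the $f$-induced relation, i.e. $\varphi=\{(C_\alpha(X),C_{f^*\alpha}(Y)):\alpha\in\mathscr D_X\}$.
   Context: A space is zero-dimensional if its closed-and-open subsets form a base. For a Tychonoff (completely regular Hausdorff) space $X$, $C(X)$ is the set of all continuous functions $X\to\mathbb R$. A nonempty family of sets $\alpha$ is directed if for any $A,B\in\alpha$ there is $E\in\alpha$ with $A\cup B\subseteq E$. $\mathscr D_X$ is the collection of all directed families $\alpha\subseteq\mathscr P(X)$. For $\alpha\in\mathscr D_X$, $C_\alpha(X)$ denotes the topology on $C(X)$ in which $U\subseteq C(X)$ is open iff for each $f\in U$ there are $A\in\alpha$ and a real $\varepsilon>0$ with $\{g\in C(X):\forall x\in A\ (|f(x)-g(x)|<\varepsilon)\}\subseteq U$. $\mathscr U_X:=\{C_\alpha(X):\alpha\in\mathscr D_X\}$, ordered by inclusion of topologies. For a function $f:X\to Y$ and $\alpha\in\mathscr D_X$, $f^*\alpha:=\{f[A]:A\in\alpha\}\in\mathscr D_Y$. *)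

theory Defs
  imports "HOL-Analysis.Analysis"
begin

definition zero_dimensional_space :: "'a topology \<Rightarrow> bool" where
  "zero_dimensional_space X \<longleftrightarrow>
     openin X = arbitrary union_of (\<lambda>B. openin X B \<and> closedin X B)"

definition tychonoff_space :: "'a topology \<Rightarrow> bool" where
  "tychonoff_space X \<longleftrightarrow> completely_regular_space X \<and> Hausdorff_space X"

(* HOL functions are total, so a function on the carrier of X is represented by its
   extensional representative, which takes the value undefined off topspace X. *)
definition cfuns :: "'a topology \<Rightarrow> ('a \<Rightarrow> real) set" where
  "cfuns X = {f \<in> extensional (topspace X). continuous_map X euclideanreal f}"

definition directed_families :: "'a topology \<Rightarrow> 'a set set set" where
  "directed_families X =
     {\<alpha>. \<alpha> \<subseteq> Pow (topspace X) \<and> \<alpha> \<noteq> {} \<and> (\<forall>A\<in>\<alpha>. \<forall>B\<in>\<alpha>. \<exists>E\<in>\<alpha>. A \<union> B \<subseteq> E)}"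

definition C_openin :: "'a topology \<Rightarrow> 'a set set \<Rightarrow> ('a \<Rightarrow> real) set \<Rightarrow> bool" where
  "C_openin X \<alpha> U \<longleftrightarrow> U \<subseteq> cfuns X \<and>
     (\<forall>f\<in>U. \<exists>A\<in>\<alpha>. \<exists>\<epsilon>>0. {g \<in> cfuns X. \<forall>x\<in>A. \<bar>f x - g x\<bar> < \<epsilon>} \<subseteq> U)"

definition C_top :: "'a topology \<Rightarrow> 'a set set \<Rightarrow> ('a \<Rightarrow> real) topology" where
  "C_top X \<alpha> = topology (C_openin X \<alpha>)"

lemma istopology_C_openin:
  assumes "\<alpha> \<in> directed_families X"
  shows "istopology (C_openin X \<alpha>)"
  unfolding istopology_def
proof (intro conjI allI impI)
  fix S T assume ST: "C_openin X \<alpha> S" "C_openin X \<alpha> T"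
  show "C_openin X \<alpha> (S \<inter> T)"
    unfolding C_openin_def
  proof (intro conjI ballI)
    show "S \<inter> T \<subseteq> cfuns X" using ST by (auto simp: C_openin_def)
    fix f assume "f \<in> S \<inter> T"
    then obtain A a B b where
      A: "A \<in> \<alpha>" "a > 0" "{g \<in> cfuns X. \<forall>x\<in>A. \<bar>f x - g x\<bar> < a} \<subseteq> S" and
      B: "B \<in> \<alpha>" "b > 0" "{g \<in> cfuns X. \<forall>x\<in>B. \<bar>f x - g x\<bar> < b} \<subseteq> T"
      using ST unfolding C_openin_def by (meson IntD1 IntD2)
    obtain E where E: "E \<in> \<alpha>" "A \<union> B \<subseteq> E"
      using assms A(1) B(1) unfolding directed_families_def by blast
    have "{g \<in> cfuns X. \<forall>x\<in>E. \<bar>f x - g x\<bar> < min a b} \<subseteq> S \<inter> T"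
      using A(3) B(3) E(2) by fastforce
    with A(2) B(2) E(1)
    show "\<exists>A\<in>\<alpha>. \<exists>\<epsilon>>0. {g \<in> cfuns X. \<forall>x\<in>A. \<bar>f x - g x\<bar> < \<epsilon>} \<subseteq> S \<inter> T"
      by (intro bexI[of _ E] exI[of _ "min a b"]) auto
  qed
next
  fix \<K> assume K: "\<forall>K\<in>\<K>. C_openin X \<alpha> K"
  show "C_openin X \<alpha> (\<Union>\<K>)"
    unfolding C_openin_def
  proof (intro conjI ballI)
    show "\<Union>\<K> \<subseteq> cfuns X" using K by (auto simp: C_openin_def)
    fix f assume "f \<in> \<Union>\<K>"
    then obtain K where "K \<in> \<K>" "f \<in> K" by blast
    with K obtain A e where "A \<in> \<alpha>" "e > 0" "{g \<in> cfuns X. \<forall>x\<in>A. \<bar>f x - g x\<bar> < e} \<subseteq> K"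
      unfolding C_openin_def by meson
    with \<open>K \<in> \<K>\<close>
    show "\<exists>A\<in>\<alpha>. \<exists>\<epsilon>>0. {g \<in> cfuns X. \<forall>x\<in>A. \<bar>f x - g x\<bar> < \<epsilon>} \<subseteq> \<Union>\<K>"
      by (meson Union_upper subset_trans)
  qed
qed

lemma openin_C_top:
  assumes "\<alpha> \<in> directed_families X"
  shows "openin (C_top X \<alpha>) U \<longleftrightarrow> U \<subseteq> cfuns X \<and>
     (\<forall>f\<in>U. \<exists>A\<in>\<alpha>. \<exists>\<epsilon>>0. {g \<in> cfuns X. \<forall>x\<in>A. \<bar>f x - g x\<bar> < \<epsilon>} \<subseteq> U)"
  using istopology_C_openin[OF assms]
  by (simp add: C_top_def topology_inverse' C_openin_def)

definition C_topologies :: "'a topology \<Rightarrow> ('a \<Rightarrow> real) topology set" where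
  "C_topologies X = C_top X ` directed_families X"

definition coarser :: "'c topology \<Rightarrow> 'c topology \<Rightarrow> bool" where
  "coarser S T \<longleftrightarrow> Collect (openin S) \<subseteq> Collect (openin T)"

definition order_isomorphism ::
  "'c set \<Rightarrow> ('c \<Rightarrow> 'c \<Rightarrow> bool) \<Rightarrow> 'd set \<Rightarrow> ('d \<Rightarrow> 'd \<Rightarrow> bool) \<Rightarrow> ('c \<Rightarrow> 'd) \<Rightarrow> bool" where
  "order_isomorphism P le Q le' \<phi> \<longleftrightarrow>
     bij_betw \<phi> P Q \<and> (\<forall>x\<in>P. \<forall>y\<in>P. le x y \<longleftrightarrow> le' (\<phi> x) (\<phi> y))"

definition push_family :: "('a \<Rightarrow> 'b) \<Rightarrow> 'a set set \<Rightarrow> 'b set set" where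
  "push_family f \<alpha> = {f ` A | A. A \<in> \<alpha>}"

lemma push_family_directed:
  assumes "f \<in> topspace X \<rightarrow> topspace Y" "\<alpha> \<in> directed_families X"
  shows "push_family f \<alpha> \<in> directed_families Y"
proof -
  have sub: "push_family f \<alpha> \<subseteq> Pow (topspace Y)"
    using assms by (auto simp: push_family_def directed_families_def Pi_iff)
  have ne: "push_family f \<alpha> \<noteq> {}"
    using assms by (auto simp: push_family_def directed_families_def)
  have "\<exists>E\<in>push_family f \<alpha>. C \<union> D \<subseteq> E" if CD: "C \<in> push_family f \<alpha>" "D \<in> push_family f \<alpha>" for C D
  proof -
    obtain A B where "A \<in> \<alpha>" "B \<in> \<alpha>" "C = f ` A" "D = f ` B"
      using CD by (auto simp: push_family_def)
    moreover then obtain E where "E \<in> \<alpha>" "A \<union> B \<subseteq> E"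
      using assms(2) unfolding directed_families_def by blast
    ultimately show ?thesis
      unfolding push_family_def by (intro bexI[of _ "f ` E"]) auto
  qed
  with sub ne show ?thesis by (simp add: directed_families_def)
qed

end

theory Submission
  imports Defs
begin

text \<open>
  For completely regular \<open>X\<close>, the topology of \<open>\<alpha>\<close> is coarser than that of \<open>\<beta>\<close> iff every member
  of \<open>\<alpha>\<close> lies in the closure of a member of \<open>\<beta>\<close>; so the ordered set of these topologies is the
  lattice of ideals of closed subsets of \<open>X\<close>.  An order isomorphism preserves the
  compact elements of this lattice, which are the topologies of one-member families, i.e. the
  closed sets.  It thus induces an isomorphism of the lattices of closed sets, and its effect on
  singletons is the homeomorphism.
\<close>

section \<open>Comparison of two topologies through closures of members\<close>

lemma openin_C_topD:
  assumes "\<alpha> \<in> directed_families X" "openin (C_top X \<alpha>) U" "f \<in> U"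
  obtains A \<epsilon> where "A \<in> \<alpha>" "\<epsilon> > 0" "{g \<in> cfuns X. \<forall>x\<in>A. \<bar>f x - g x\<bar> < \<epsilon>} \<subseteq> U"
  using assms(2,3) unfolding openin_C_top[OF assms(1)] by meson

lemma restrict_in_cfuns:
  assumes "continuous_map X euclideanreal g"
  shows "restrict g (topspace X) \<in> cfuns X"
  using assms by (auto simp: cfuns_def intro: continuous_map_eq)

text \<open>Continuity carries a bound on \<open>\<bar>f x - g x\<bar>\<close> from \<open>B\<close>
  to its closure, so closeness on \<open>B\<close> controls closeness on \<open>A\<close>.\<close>

lemma coarser_C_topI:
  assumes \<alpha>: "\<alpha> \<in> directed_families X" and \<beta>: "\<beta> \<in> directed_families X"
    and dom: "\<And>A. A \<in> \<alpha> \<Longrightarrow> \<exists>B\<in>\<beta>. A \<subseteq> X closure_of B"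
  shows "coarser (C_top X \<alpha>) (C_top X \<beta>)"
proof -
  have "openin (C_top X \<beta>) U" if U: "openin (C_top X \<alpha>) U" for U
    unfolding openin_C_top[OF \<beta>]
  proof (intro conjI ballI)
    show sub: "U \<subseteq> cfuns X" using U openin_C_top[OF \<alpha>] by blast
    fix f assume f: "f \<in> U"
    obtain A \<epsilon> where A: "A \<in> \<alpha>" "\<epsilon> > 0" "{g \<in> cfuns X. \<forall>x\<in>A. \<bar>f x - g x\<bar> < \<epsilon>} \<subseteq> U"
      using openin_C_topD[OF \<alpha> U f] .
    obtain B where B: "B \<in> \<beta>" "A \<subseteq> X closure_of B" using dom A(1) by blast
    have BX: "B \<subseteq> topspace X" using B(1) \<beta> by (auto simp: directed_families_def)
    \<comment> \<open>On the closure the strict bound survives only as \<open>\<le>\<close>; half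
      the radius leaves room for the strict bound \<open>\<epsilon>\<close> on
      \<open>A\<close>.\<close>
    have "g \<in> U" if g: "g \<in> cfuns X" "\<forall>x\<in>B. \<bar>f x - g x\<bar> < \<epsilon>/2" for g
    proof -
      have "continuous_map X euclideanreal (\<lambda>x. \<bar>f x - g x\<bar>)"
        using f sub g(1)
        by (intro continuous_map_real_abs continuous_map_diff) (auto simp: cfuns_def)
      then have "closedin X {x \<in> topspace X. \<bar>f x - g x\<bar> \<in> {..\<epsilon>/2}}"
        by (rule closedin_continuous_map_preimage) auto
      moreover have "B \<subseteq> {x \<in> topspace X. \<bar>f x - g x\<bar> \<in> {..\<epsilon>/2}}"
        using BX g(2) by (auto intro: less_imp_le)
      ultimately have "A \<subseteq> {x \<in> topspace X. \<bar>f x - g x\<bar> \<in> {..\<epsilon>/2}}"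
        using B(2) closure_of_minimal by blast
      then have "\<forall>x\<in>A. \<bar>f x - g x\<bar> < \<epsilon>" using A(2) by fastforce
      then show ?thesis using A(3) g(1) by blast
    qed
    then show "\<exists>B\<in>\<beta>. \<exists>\<epsilon>>0. {g \<in> cfuns X. \<forall>x\<in>B. \<bar>f x - g x\<bar> < \<epsilon>} \<subseteq> U"
      using A(2) B(1) by (intro bexI[of _ B] exI[of _ "\<epsilon>/2"]) auto
  qed
  then show ?thesis by (auto simp: coarser_def)
qed

text \<open>A neighbourhood of the zero function that is small on \<open>A\<close> must contain a
  basic one given by some \<open>B\<close> in \<open>\<beta>\<close>. A point of \<open>A\<close>
  outside the closure of \<open>B\<close> would allow a function vanishing on \<open>B\<close> but
  equal to 1 at that point.\<close>

lemma coarser_C_topD: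
  assumes X: "completely_regular_space X"
    and \<alpha>: "\<alpha> \<in> directed_families X" and \<beta>: "\<beta> \<in> directed_families X"
    and le: "coarser (C_top X \<alpha>) (C_top X \<beta>)" and A: "A \<in> \<alpha>"
  shows "\<exists>B\<in>\<beta>. A \<subseteq> X closure_of B"
proof -
  \<comment> \<open>The uniform gap below 1 makes \<open>U\<close> open; a pointwise bound
    \<open>\<bar>g x\<bar> < 1\<close> on an infinite \<open>A\<close> may leave no common
    radius.\<close>
  define U where "U = {g \<in> cfuns X. \<exists>\<delta><1. \<forall>x\<in>A. \<bar>g x\<bar> \<le> \<delta>}"
  define z where "z = restrict (\<lambda>x. 0::real) (topspace X)"
  have AX: "A \<subseteq> topspace X" using A \<alpha> by (auto simp: directed_families_def)
  have "openin (C_top X \<alpha>) U"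
    unfolding openin_C_top[OF \<alpha>]
  proof (intro conjI ballI)
    show "U \<subseteq> cfuns X" by (auto simp: U_def)
    fix f assume "f \<in> U"
    then obtain \<delta> where \<delta>: "\<delta> < 1" "\<And>x. x \<in> A \<Longrightarrow> \<bar>f x\<bar> \<le> \<delta>" unfolding U_def by blast
    \<comment> \<open>The radius is half the gap, so the new bound \<open>(1 + \<delta>)/2\<close>
      is the midpoint of \<open>\<delta>\<close> and 1.\<close>
    have "{g \<in> cfuns X. \<forall>x\<in>A. \<bar>f x - g x\<bar> < (1 - \<delta>)/2} \<subseteq> U"
    proof clarify
      fix g assume g: "g \<in> cfuns X" "\<forall>x\<in>A. \<bar>f x - g x\<bar> < (1 - \<delta>)/2"
      have "\<bar>g x\<bar> \<le> (1 + \<delta>)/2" if "x \<in> A" for x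
        using \<delta>(2)[OF that] bspec[OF g(2) that] by (simp add: field_simps abs_if split: if_splits)
      moreover have "(1 + \<delta>)/2 < 1" using \<delta>(1) by simp
      ultimately show "g \<in> U" using g(1) unfolding U_def by blast
    qed
    then show "\<exists>A\<in>\<alpha>. \<exists>\<epsilon>>0. {g \<in> cfuns X. \<forall>x\<in>A. \<bar>f x - g x\<bar> < \<epsilon>} \<subseteq> U"
      using A \<delta>(1) by (intro bexI[of _ A] exI[of _ "(1 - \<delta>)/2"]) auto
  qed
  then have U: "openin (C_top X \<beta>) U" using le by (auto simp: coarser_def)
  have z: "z \<in> U"
    unfolding U_def
  proof (intro CollectI conjI exI[of _ "0::real"])
    show "z \<in> cfuns X" unfolding z_def by (intro restrict_in_cfuns) auto
    show "\<forall>x\<in>A. \<bar>z x\<bar> \<le> 0" using AX by (auto simp: z_def)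
  qed simp
  obtain B \<epsilon> where B: "B \<in> \<beta>" "\<epsilon> > 0" "{g \<in> cfuns X. \<forall>x\<in>B. \<bar>z x - g x\<bar> < \<epsilon>} \<subseteq> U"
    using openin_C_topD[OF \<beta> U z] .
  have BX: "B \<subseteq> topspace X" using B(1) \<beta> by (auto simp: directed_families_def)
  have "x \<in> X closure_of B" if x: "x \<in> A" for x
  proof (rule ccontr)
    assume "x \<notin> X closure_of B"
    then obtain h where h: "continuous_map X (top_of_set {0..1::real}) h" "h x = 0"
        "h ` (X closure_of B) \<subseteq> {1}"
      using X x AX closedin_closure_of[of X B] unfolding completely_regular_space_def
      by (metis DiffI subsetD)
    \<comment> \<open>The separating function is 0 at \<open>x\<close> and 1 on the closure of
      \<open>B\<close>; flipping it gives agreement with \<open>z\<close> on \<open>B\<close> and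
      the forbidden value 1 at \<open>x\<close>.\<close>
    define g where "g = restrict (\<lambda>x. 1 - h x) (topspace X)"
    have "continuous_map X euclideanreal h"
      using h(1) continuous_map_in_subtopology by blast
    then have "g \<in> cfuns X"
      unfolding g_def by (intro restrict_in_cfuns continuous_map_diff) auto
    moreover have "g y = 0" if "y \<in> B" for y
      using h(3) that BX closure_of_subset[OF BX] by (auto simp: g_def)
    moreover have "z y = 0" if "y \<in> B" for y
      using that BX by (auto simp: z_def)
    ultimately have "g \<in> {g \<in> cfuns X. \<forall>x\<in>B. \<bar>z x - g x\<bar> < \<epsilon>}" using B(2) by simp
    then have "g \<in> U" using B(3) by blast
    then obtain \<delta> where "\<delta> < 1" "\<bar>g x\<bar> \<le> \<delta>" using x unfolding U_def by blast
    moreover have "g x = 1" using h(2) x AX by (auto simp: g_def)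
    ultimately show False by simp
  qed
  then show ?thesis using B(1) by blast
qed

lemma coarser_C_top_iff:
  assumes "completely_regular_space X" "\<alpha> \<in> directed_families X" "\<beta> \<in> directed_families X"
  shows "coarser (C_top X \<alpha>) (C_top X \<beta>) \<longleftrightarrow> (\<forall>A\<in>\<alpha>. \<exists>B\<in>\<beta>. A \<subseteq> X closure_of B)"
  using coarser_C_topI[OF assms(2,3)] coarser_C_topD[OF assms] by blast

section \<open>One-member families as building blocks of the order\<close>

lemma coarser_refl: "coarser S S"
  by (simp add: coarser_def)

lemma coarser_trans: "coarser S T \<Longrightarrow> coarser T R \<Longrightarrow> coarser S R"
  by (auto simp: coarser_def)

lemma coarser_antisym: "coarser S T \<Longrightarrow> coarser T S \<Longrightarrow> S = T"
  by (auto simp: coarser_def topology_eq)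

lemma singleton_directed: "{A} \<in> directed_families X \<longleftrightarrow> A \<subseteq> topspace X"
  by (auto simp: directed_families_def)

lemma directed_familiesD: "\<alpha> \<in> directed_families X \<Longrightarrow> A \<in> \<alpha> \<Longrightarrow> A \<subseteq> topspace X"
  by (auto simp: directed_families_def)

lemma C_top_in_C_topologies: "\<alpha> \<in> directed_families X \<Longrightarrow> C_top X \<alpha> \<in> C_topologies X"
  by (simp add: C_topologies_def)

lemma coarser_singleton_iff:
  assumes "completely_regular_space X" "A \<subseteq> topspace X" "B \<subseteq> topspace X"
  shows "coarser (C_top X {A}) (C_top X {B}) \<longleftrightarrow> A \<subseteq> X closure_of B"
  using assms by (simp add: coarser_C_top_iff singleton_directed)

text \<open>By antisymmetry, equality means that each set lies in the closure of the other. The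
  topologies of one-member families thus correspond to the closed sets.\<close>

lemma C_top_singleton_eq_iff:
  assumes X: "completely_regular_space X" and AB: "A \<subseteq> topspace X" "B \<subseteq> topspace X"
  shows "C_top X {A} = C_top X {B} \<longleftrightarrow> X closure_of A = X closure_of B"
proof -
  have "C \<subseteq> X closure_of D \<longleftrightarrow> X closure_of C \<subseteq> X closure_of D" if "C \<subseteq> topspace X" for C D
    using closure_of_subset[OF that] closure_of_minimal[of C "X closure_of D" X]
    by (auto simp: closedin_closure_of)
  then show ?thesis
    using coarser_singleton_iff[OF X AB] coarser_singleton_iff[OF X AB(2,1)] AB
      coarser_refl[of "C_top X {A}"] coarser_antisym[of "C_top X {A}" "C_top X {B}"]
    by auto
qed

lemma coarser_singleton_member:
  assumes "\<alpha> \<in> directed_families X" "A \<in> \<alpha>"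
  shows "coarser (C_top X {A}) (C_top X \<alpha>)"
  using assms directed_familiesD[OF assms] closure_of_subset[of A X]
  by (intro coarser_C_topI) (auto simp: singleton_directed)

text \<open>The closure criterion tests the members of \<open>\<alpha>\<close> one by one. Hence
  \<open>C_top X \<alpha>\<close> is the supremum in \<open>C_topologies X\<close> of the topologies
  of its members.\<close>

lemma coarser_C_top_pointwise:
  assumes X: "completely_regular_space X"
    and \<alpha>: "\<alpha> \<in> directed_families X" and T: "T \<in> C_topologies X"
  shows "coarser (C_top X \<alpha>) T \<longleftrightarrow> (\<forall>A\<in>\<alpha>. coarser (C_top X {A}) T)"
proof -
  obtain \<beta> where "\<beta> \<in> directed_families X" "T = C_top X \<beta>" using T by (auto simp: C_topologies_def)
  then show ?thesis
    using X \<alpha> directed_familiesD[OF \<alpha>] by (simp add: coarser_C_top_iff singleton_directed)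
qed

text \<open>Two members of \<open>\<beta>\<close> whose closures cover \<open>A\<close> and
  \<open>B\<close> lie in a common member, whose closure covers both. The sets whose topologies lie
  below \<open>T\<close> therefore form an ideal.\<close>

lemma coarser_singleton_Un:
  assumes X: "completely_regular_space X" and T: "T \<in> C_topologies X"
    and AB: "A \<subseteq> topspace X" "B \<subseteq> topspace X"
    and le: "coarser (C_top X {A}) T" "coarser (C_top X {B}) T"
  shows "coarser (C_top X {A \<union> B}) T"
proof -
  obtain \<beta> where \<beta>: "\<beta> \<in> directed_families X" and T_eq: "T = C_top X \<beta>"
    using T by (auto simp: C_topologies_def)
  obtain C D where CD: "C \<in> \<beta>" "D \<in> \<beta>" "A \<subseteq> X closure_of C" "B \<subseteq> X closure_of D"
    using le AB X \<beta> unfolding T_eq by (auto simp: coarser_C_top_iff singleton_directed)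
  then obtain E where "E \<in> \<beta>" "C \<union> D \<subseteq> E" using \<beta> unfolding directed_families_def by blast
  moreover from this CD have "A \<union> B \<subseteq> X closure_of E"
    using closure_of_mono[of C E X] closure_of_mono[of D E X] by blast
  ultimately show ?thesis
    using X \<beta> AB unfolding T_eq by (auto simp: coarser_C_top_iff singleton_directed)
qed

section \<open>Order isomorphisms and one-member families\<close>

lemma order_isomorphism_inv:
  assumes "order_isomorphism P le Q le' \<phi>"
  shows "order_isomorphism Q le' P le (inv_into P \<phi>)"
  using assms unfolding order_isomorphism_def
  by (smt (verit) bij_betw_def bij_betw_inv_into f_inv_into_f inv_into_into)

text \<open>This is compactness of the topologies of one-member families: writing the image of one as
  the supremum of the directed set of topologies of the members of \<open>\<beta>\<close> and pulling
  back, one of the pullbacks already exceeds the original topology.\<close>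

lemma order_isomorphism_singleton:
  assumes X: "completely_regular_space X" and Y: "completely_regular_space Y"
    and iso: "order_isomorphism (C_topologies X) coarser (C_topologies Y) coarser \<phi>"
    and A: "A \<subseteq> topspace X"
  shows "\<exists>B. B \<subseteq> topspace Y \<and> \<phi> (C_top X {A}) = C_top Y {B}"
proof -
  define \<psi> where "\<psi> = inv_into (C_topologies X) \<phi>"
  have mono: "coarser (\<phi> S) (\<phi> T) \<longleftrightarrow> coarser S T"
    if "S \<in> C_topologies X" "T \<in> C_topologies X" for S T
    using iso that by (auto simp: order_isomorphism_def)
  have bij: "bij_betw \<phi> (C_topologies X) (C_topologies Y)"
    using iso by (auto simp: order_isomorphism_def)
  have \<phi>: "\<phi> S \<in> C_topologies Y" if "S \<in> C_topologies X" for S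
    using bij that by (auto simp: bij_betw_def)
  have \<psi>: "\<psi> T \<in> C_topologies X" "\<phi> (\<psi> T) = T" if "T \<in> C_topologies Y" for T
    using bij that unfolding \<psi>_def by (auto simp: bij_betw_def inv_into_into f_inv_into_f)
  have inX: "C_top X {G} \<in> C_topologies X" if "G \<subseteq> topspace X" for G
    using that by (simp add: C_top_in_C_topologies singleton_directed)
  have inY: "C_top Y {G} \<in> C_topologies Y" if "G \<subseteq> topspace Y" for G
    using that by (simp add: C_top_in_C_topologies singleton_directed)
  obtain \<beta> where \<beta>: "\<beta> \<in> directed_families Y" and \<phi>A: "\<phi> (C_top X {A}) = C_top Y \<beta>"
    using \<phi>[OF inX[OF A]] by (auto simp: C_topologies_def)
  have \<beta>Y: "B \<subseteq> topspace Y" if "B \<in> \<beta>" for B using directed_familiesD[OF \<beta> that] .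
  \<comment> \<open>This is the union of the ideals of the pullbacks
    \<open>\<psi> (C_top Y {B})\<close>, chosen so that \<open>C_top X \<gamma>\<close> bounds all
    of them.\<close>
  define \<gamma> where "\<gamma> = {G. G \<subseteq> topspace X \<and> (\<exists>B\<in>\<beta>. coarser (C_top X {G}) (\<psi> (C_top Y {B})))}"
  have \<gamma>I: "G \<in> \<gamma>"
    if "G \<subseteq> topspace X" "B \<in> \<beta>" "coarser (C_top X {G}) (\<psi> (C_top Y {B}))" for G B
    using that unfolding \<gamma>_def by blast
  have \<gamma>: "\<gamma> \<in> directed_families X"
    unfolding directed_families_def
  proof (intro CollectI conjI ballI)
    show "\<gamma> \<subseteq> Pow (topspace X)" by (auto simp: \<gamma>_def)
    obtain B where B: "B \<in> \<beta>" using \<beta> by (auto simp: directed_families_def)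
    obtain \<delta> where \<delta>: "\<delta> \<in> directed_families X" "\<psi> (C_top Y {B}) = C_top X \<delta>"
      using \<psi>(1)[OF inY[OF \<beta>Y[OF B]]] by (auto simp: C_topologies_def)
    then obtain D where "D \<in> \<delta>" by (auto simp: directed_families_def)
    then have "D \<in> \<gamma>"
      using coarser_singleton_member[OF \<delta>(1)] directed_familiesD[OF \<delta>(1)] \<delta>(2)
      by (intro \<gamma>I[OF _ B]) auto
    then show "\<gamma> \<noteq> {}" by blast
  next
    fix G H assume "G \<in> \<gamma>" "H \<in> \<gamma>"
    then obtain B C where GH: "G \<subseteq> topspace X" "H \<subseteq> topspace X" "B \<in> \<beta>" "C \<in> \<beta>"
        "coarser (C_top X {G}) (\<psi> (C_top Y {B}))" "coarser (C_top X {H}) (\<psi> (C_top Y {C}))"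
      unfolding \<gamma>_def by blast
    then obtain E where E: "E \<in> \<beta>" "B \<union> C \<subseteq> E" using \<beta> unfolding directed_families_def by blast
    \<comment> \<open>Monotonicity of \<open>\<psi>\<close> moves \<open>G\<close> and
      \<open>H\<close> below the same pullback, that of \<open>E\<close>, where unions can be
      formed.\<close>
    have up: "coarser (\<psi> (C_top Y {D})) (\<psi> (C_top Y {E}))" if "D \<in> \<beta>" "D \<subseteq> E" for D
    proof -
      have "D \<subseteq> Y closure_of E"
        using that closure_of_subset[OF \<beta>Y[OF E(1)]] by blast
      then have "coarser (C_top Y {D}) (C_top Y {E})"
        using that E \<beta>Y Y by (simp add: coarser_singleton_iff)
      then show ?thesis
        using mono[of "\<psi> (C_top Y {D})" "\<psi> (C_top Y {E})"] \<psi> inY \<beta>Y that E by simp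
    qed
    have "coarser (C_top X {G}) (\<psi> (C_top Y {E}))" "coarser (C_top X {H}) (\<psi> (C_top Y {E}))"
      using coarser_trans[OF GH(5) up] coarser_trans[OF GH(6) up] GH(3,4) E(2) by simp_all
    then have "coarser (C_top X {G \<union> H}) (\<psi> (C_top Y {E}))"
      using GH(1,2) by (intro coarser_singleton_Un X \<psi>(1) inY \<beta>Y E(1))
    then have "G \<union> H \<in> \<gamma>" using GH(1,2) E(1) by (intro \<gamma>I) auto
    then show "\<exists>E\<in>\<gamma>. G \<union> H \<subseteq> E" by blast
  qed
  have "coarser (C_top Y {B}) (\<phi> (C_top X \<gamma>))" if B: "B \<in> \<beta>" for B
  proof -
    obtain \<delta> where \<delta>: "\<delta> \<in> directed_families X" "\<psi> (C_top Y {B}) = C_top X \<delta>"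
      using \<psi>(1)[OF inY[OF \<beta>Y[OF B]]] by (auto simp: C_topologies_def)
    \<comment> \<open>Each member of a family representing the pullback has its own topology below
      that pullback.\<close>
    have "\<delta> \<subseteq> \<gamma>"
      using coarser_singleton_member[OF \<delta>(1)] directed_familiesD[OF \<delta>(1)] \<delta>(2)
      by (intro subsetI \<gamma>I[OF _ B]) auto
    then have "coarser (\<psi> (C_top Y {B})) (C_top X \<gamma>)"
      unfolding \<delta>(2) coarser_C_top_pointwise[OF X \<delta>(1) C_top_in_C_topologies[OF \<gamma>]]
      using coarser_singleton_member[OF \<gamma>] by blast
    then show ?thesis
      using mono[of "\<psi> (C_top Y {B})" "C_top X \<gamma>"] \<psi>[OF inY[OF \<beta>Y[OF B]]]
        C_top_in_C_topologies[OF \<gamma>] by simp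
  qed
  then have "coarser (\<phi> (C_top X {A})) (\<phi> (C_top X \<gamma>))"
    unfolding \<phi>A using Y \<beta> \<gamma> by (simp add: coarser_C_top_pointwise \<phi> C_top_in_C_topologies)
  then have "coarser (C_top X {A}) (C_top X \<gamma>)"
    using mono[OF inX[OF A] C_top_in_C_topologies[OF \<gamma>]] by simp
  \<comment> \<open>Compactness enters here: the closure criterion for \<open>{A}\<close> yields one
    \<open>G\<close> in \<open>\<gamma>\<close>, and \<open>G\<close> comes with one
    \<open>B\<close> in \<open>\<beta>\<close>.\<close>
  then obtain G where G: "G \<in> \<gamma>" "A \<subseteq> X closure_of G"
    using coarser_C_topD[OF X _ \<gamma>, of "{A}" A] A by (auto simp: singleton_directed)
  then obtain B where B: "B \<in> \<beta>" "coarser (C_top X {G}) (\<psi> (C_top Y {B}))" "G \<subseteq> topspace X"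
    unfolding \<gamma>_def by blast
  then have "coarser (C_top X {A}) (\<psi> (C_top Y {B}))"
    using coarser_singleton_iff[OF X A B(3)] G(2) coarser_trans[OF _ B(2)] by simp
  then have "coarser (\<phi> (C_top X {A})) (C_top Y {B})"
    using mono[of "C_top X {A}" "\<psi> (C_top Y {B})"] \<psi> inY \<beta>Y B(1) inX A by simp
  moreover have "coarser (C_top Y {B}) (\<phi> (C_top X {A}))"
    unfolding \<phi>A by (rule coarser_singleton_member[OF \<beta> B(1)])
  ultimately have "\<phi> (C_top X {A}) = C_top Y {B}" by (rule coarser_antisym)
  then show ?thesis using \<beta>Y[OF B(1)] by blast
qed

section \<open>From an order isomorphism to a homeomorphism\<close>

lemma closure_of_singleton_t1:
  assumes "t1_space X" "x \<in> topspace X"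
  shows "X closure_of {x} = {x}"
  using assms by (simp add: closure_of_closedin closedin_t1_singleton)

text \<open>In a T1 space the singletons are the minimal nonempty closed sets, so they correspond
  under the isomorphism and define \<open>f\<close>. Since inclusion of closures is transferred too,
  \<open>f\<close> carries closed sets to closed sets in both directions.\<close>

lemma order_isomorphism_imp_homeomorphic_map:
  fixes X :: "'a topology" and Y :: "'b topology"
  assumes X: "completely_regular_space X" "t1_space X"
    and Y: "completely_regular_space Y" "t1_space Y"
    and iso: "order_isomorphism (C_topologies X) coarser (C_topologies Y) coarser \<phi>"
  obtains f where "homeomorphic_map X Y f"
    "\<And>\<alpha>. \<alpha> \<in> directed_families X \<Longrightarrow> \<phi> (C_top X \<alpha>) = C_top Y (push_family f \<alpha>)"
proof -
  define \<psi> where "\<psi> = inv_into (C_topologies X) \<phi>"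
  have mono: "coarser (\<phi> S) (\<phi> T) \<longleftrightarrow> coarser S T"
    if "S \<in> C_topologies X" "T \<in> C_topologies X" for S T
    using iso that by (auto simp: order_isomorphism_def)
  have bij: "bij_betw \<phi> (C_topologies X) (C_topologies Y)"
    using iso by (auto simp: order_isomorphism_def)
  have \<phi>\<psi>: "\<phi> (\<psi> T) = T" if "T \<in> C_topologies Y" for T
    using bij that unfolding \<psi>_def by (auto simp: bij_betw_def f_inv_into_f)
  have inX: "C_top X {G} \<in> C_topologies X" if "G \<subseteq> topspace X" for G
    using that by (simp add: C_top_in_C_topologies singleton_directed)
  have inY: "C_top Y {G} \<in> C_topologies Y" if "G \<subseteq> topspace Y" for G
    using that by (simp add: C_top_in_C_topologies singleton_directed)
  \<comment> \<open>The sets \<open>g A\<close> and \<open>h B\<close> are arbitrary choices; only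
    their closures are determined, so later comparisons pass through closures.\<close>
  obtain g where g: "\<And>A. A \<subseteq> topspace X \<Longrightarrow> g A \<subseteq> topspace Y"
      "\<And>A. A \<subseteq> topspace X \<Longrightarrow> \<phi> (C_top X {A}) = C_top Y {g A}"
    using order_isomorphism_singleton[OF X(1) Y(1) iso] by metis
  obtain h where h: "\<And>B. B \<subseteq> topspace Y \<Longrightarrow> h B \<subseteq> topspace X"
      "\<And>B. B \<subseteq> topspace Y \<Longrightarrow> \<psi> (C_top Y {B}) = C_top X {h B}"
    using order_isomorphism_singleton[OF Y(1) X(1) order_isomorphism_inv[OF iso]]
    unfolding \<psi>_def by metis
  have gh: "C_top Y {g (h B)} = C_top Y {B}" if "B \<subseteq> topspace Y" for B
    using \<phi>\<psi>[OF inY[OF that]] h[OF that] g(2)[of "h B"] by simp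
  have g_iff: "A \<subseteq> X closure_of B \<longleftrightarrow> g A \<subseteq> Y closure_of g B"
    if "A \<subseteq> topspace X" "B \<subseteq> topspace X" for A B
    using mono[OF inX[OF that(1)] inX[OF that(2)]] g that X Y
    by (simp add: coarser_singleton_iff)
  have gh_iff: "B \<subseteq> Y closure_of g A \<longleftrightarrow> h B \<subseteq> X closure_of A"
    if "A \<subseteq> topspace X" "B \<subseteq> topspace Y" for A B
    using gh[OF that(2)] g_iff[of "h B" A] that g(1) h(1) Y(1)
    by (metis coarser_singleton_iff)
  have cl_gh: "Y closure_of g (h B) = Y closure_of B" if B: "B \<subseteq> topspace Y" for B
    using gh[OF B] C_top_singleton_eq_iff[OF Y(1) g(1)[OF h(1)[OF B]] B] by simp
  have h_empty: "h B = {} \<longleftrightarrow> B = {}" if B: "B \<subseteq> topspace Y" for B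
  proof -
    \<comment> \<open>The empty set lies below \<open>h {}\<close>, and \<open>g (h {})\<close> has
      the same closure as \<open>{}\<close>; this forces \<open>g {}\<close> to be empty.\<close>
    have "g {} \<subseteq> Y closure_of g (h {})" using g_iff[of "{}" "h {}"] h(1)[of "{}"] by simp
    moreover have "Y closure_of g (h {}) = {}"
      using cl_gh[of "{}"] by simp
    ultimately have "g {} = {}" by blast
    then show ?thesis using gh_iff[of "{}" B] B by simp
  qed
  have "\<exists>y\<in>topspace Y. Y closure_of g {x} = {y}" if x: "x \<in> topspace X" for x
  proof -
    have "g {x} \<noteq> {}"
    proof
      assume "g {x} = {}"
      then have "g {x} \<subseteq> Y closure_of g {}" by simp
      then show False using g_iff[of "{x}" "{}"] x by simp
    qed
    then obtain y where y: "y \<in> g {x}" by blast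
    then have yY: "y \<in> topspace Y" using g(1)[of "{x}"] x by blast
    have "{y} \<subseteq> Y closure_of g {x}" using y closure_of_subset[OF g(1)[of "{x}"]] x by blast
    \<comment> \<open>Minimality of \<open>{x}\<close>: the nonempty set \<open>h {y}\<close> inside
      it must be all of it, so \<open>g {x}\<close> and \<open>{y}\<close> have the same
      closure.\<close>
    then have "h {y} \<subseteq> X closure_of {x}" using gh_iff[of "{x}" "{y}"] x yY by simp
    then have "h {y} = {x}"
      using closure_of_singleton_t1[OF X(2) x] h_empty[of "{y}"] yY by auto
    then have "Y closure_of g {x} = {y}"
      using cl_gh[of "{y}"] closure_of_singleton_t1[OF Y(2) yY] yY by simp
    then show ?thesis using yY by blast
  qed
  then obtain f where f: "\<And>x. x \<in> topspace X \<Longrightarrow> f x \<in> topspace Y"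
      "\<And>x. x \<in> topspace X \<Longrightarrow> Y closure_of g {x} = {f x}"
    by metis
  \<comment> \<open>This is \<open>g_iff\<close> for \<open>{x}\<close>, because
    \<open>{f x}\<close> is the closure of \<open>g {x}\<close>. Bijectivity, closedness and
    continuity of \<open>f\<close> are all read off from it.\<close>
  have f_iff: "f x \<in> Y closure_of g A \<longleftrightarrow> x \<in> X closure_of A"
    if x: "x \<in> topspace X" and A: "A \<subseteq> topspace X" for x A
  proof -
    have "g {x} \<subseteq> Y closure_of g A \<longleftrightarrow> Y closure_of g {x} \<subseteq> Y closure_of g A"
      using closure_of_subset[OF g(1)[of "{x}"]] closure_of_minimal[of "g {x}" "Y closure_of g A" Y] x
      by (auto simp: closedin_closure_of)
    then show ?thesis using g_iff[of "{x}" A] x A f(2)[OF x] by simp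
  qed
  have surj: "f ` topspace X = topspace Y"
  proof
    show "f ` topspace X \<subseteq> topspace Y" using f(1) by blast
    show "topspace Y \<subseteq> f ` topspace X"
    proof
      fix y assume y: "y \<in> topspace Y"
      \<comment> \<open>Any point of \<open>h {y}\<close> is a preimage of \<open>y\<close>, since
        its image lies in the closure of \<open>g (h {y})\<close>, which is
        \<open>{y}\<close>.\<close>
      obtain x where x: "x \<in> h {y}" using h_empty[of "{y}"] y by auto
      then have xX: "x \<in> topspace X" using h(1)[of "{y}"] y by blast
      have "f x \<in> Y closure_of g (h {y})"
        using f_iff[OF xX h(1)[of "{y}"]] x closure_of_subset[OF h(1)[of "{y}"]] y by auto
      then have "f x = y"
        using cl_gh[of "{y}"] closure_of_singleton_t1[OF Y(2) y] y by simp
      then show "y \<in> f ` topspace X" using xX by blast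
    qed
  qed
  have inj: "inj_on f (topspace X)"
  proof
    fix x x' assume x: "x \<in> topspace X" "x' \<in> topspace X" "f x = f x'"
    then have "f x \<in> Y closure_of g {x'}" using f(2)[of x'] by simp
    then show "x = x'" using f_iff[of x "{x'}"] x closure_of_singleton_t1[OF X(2)] by simp
  qed
  have cl: "Y closure_of g A = f ` (X closure_of A)" if A: "A \<subseteq> topspace X" for A
  proof -
    have "Y closure_of g A \<subseteq> f ` topspace X" using surj closure_of_subset_topspace by metis
    then show ?thesis using f_iff[OF _ A] closure_of_subset_topspace[of X A] by blast
  qed
  have "closedin Y (f ` C)" if "closedin X C" for C
    using cl[of C] that closedin_subset[OF that] closedin_closure_of[of Y "g C"]
    by (simp add: closure_of_closedin)
  then have closed: "closed_map X Y f" by (simp add: closed_map_def)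
  have "closedin X {x \<in> topspace X. f x \<in> C}" if C: "closedin Y C" for C
  proof -
    have CY: "C \<subseteq> topspace Y" using C closedin_subset by blast
    have "Y closure_of g (h C) = C" using cl_gh[OF CY] C by (simp add: closure_of_closedin)
    \<comment> \<open>With \<open>C\<close> written as the closure of \<open>g (h C)\<close>,
      \<open>f_iff\<close> identifies its preimage as a closure.\<close>
    then have "{x \<in> topspace X. f x \<in> C} = X closure_of h C"
      using f_iff[OF _ h(1)[OF CY]] closure_of_subset_topspace[of X "h C"] by blast
    then show ?thesis by simp
  qed
  then have "continuous_map X Y f" using f(1) by (auto simp: continuous_map_closedin)
  then have homeo: "homeomorphic_map X Y f"
    using closed surj inj by (intro bijective_closed_imp_homeomorphic_map)
  have single: "\<phi> (C_top X {A}) = C_top Y {f ` A}" if A: "A \<subseteq> topspace X" for A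
  proof -
    have fA: "f ` A \<subseteq> topspace Y" using A f(1) by blast
    \<comment> \<open>Both closures equal \<open>f\<close> applied to the closure of
      \<open>A\<close>, so the image under \<open>f\<close> can replace the arbitrary choice
      \<open>g A\<close>.\<close>
    have "Y closure_of g A = Y closure_of (f ` A)"
      using homeomorphic_map_closure_of[OF homeo A] cl[OF A] by simp
    then show ?thesis
      unfolding g(2)[OF A] using C_top_singleton_eq_iff[OF Y(1) g(1)[OF A] fA] by simp
  qed
  have "\<phi> (C_top X \<alpha>) = C_top Y (push_family f \<alpha>)" if \<alpha>: "\<alpha> \<in> directed_families X" for \<alpha>
  proof -
    have pf: "push_family f \<alpha> \<in> directed_families Y"
      using f(1) \<alpha> by (intro push_family_directed) auto
    have T: "C_top X \<alpha> \<in> C_topologies X" using \<alpha> by (rule C_top_in_C_topologies)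
    have up: "coarser (C_top Y {f ` A}) (\<phi> (C_top X \<alpha>)) \<longleftrightarrow> coarser (C_top X {A}) (C_top X \<alpha>)"
      if "A \<subseteq> topspace X" for A
      using mono[OF inX[OF that] T] single[OF that] by simp
    obtain \<beta> where \<beta>: "\<beta> \<in> directed_families Y" "\<phi> (C_top X \<alpha>) = C_top Y \<beta>"
      using bij T by (auto simp: bij_betw_def C_topologies_def)
    have "coarser (C_top Y (push_family f \<alpha>)) (\<phi> (C_top X \<alpha>))"
      unfolding \<beta>(2) coarser_C_top_pointwise[OF Y(1) pf C_top_in_C_topologies[OF \<beta>(1)]]
      using up[unfolded \<beta>(2)] directed_familiesD[OF \<alpha>] coarser_singleton_member[OF \<alpha>]
      by (auto simp: push_family_def)
    moreover have "\<exists>D\<in>push_family f \<alpha>. B \<subseteq> Y closure_of D" if B: "B \<in> \<beta>" for B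
    proof -
      have BY: "B \<subseteq> topspace Y" using directed_familiesD[OF \<beta>(1) B] .
      \<comment> \<open>Pulling \<open>B\<close> back along the bijection \<open>f\<close> turns the
        comparison with \<open>\<phi> (C_top X \<alpha>)\<close> into one with
        \<open>C_top X \<alpha>\<close>, where the closure criterion supplies
        \<open>D\<close>.\<close>
      define A where "A = {x \<in> topspace X. f x \<in> B}"
      have A: "A \<subseteq> topspace X" "f ` A = B" using BY unfolding surj[symmetric] A_def by auto
      have "coarser (C_top X {A}) (C_top X \<alpha>)"
        using up[OF A(1)] coarser_singleton_member[OF \<beta>(1) B] \<beta>(2) A(2) by simp
      then obtain D where D: "D \<in> \<alpha>" "A \<subseteq> X closure_of D"
        using X(1) A(1) \<alpha> by (auto simp: coarser_C_top_iff singleton_directed)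
      then have "B \<subseteq> Y closure_of (f ` D)"
        using homeomorphic_map_closure_of[OF homeo directed_familiesD[OF \<alpha> D(1)]] A(2) by blast
      then show ?thesis using D(1) by (auto simp: push_family_def)
    qed
    then have "coarser (\<phi> (C_top X \<alpha>)) (C_top Y (push_family f \<alpha>))"
      unfolding \<beta>(2) by (intro coarser_C_topI \<beta>(1) pf)
    ultimately show ?thesis by (intro coarser_antisym)
  qed
  then show ?thesis using that homeo by blast
qed

section \<open>From a homeomorphism to an order isomorphism\<close>

lemma push_family_eq_image: "push_family f \<alpha> = (`) f ` \<alpha>"
  by (auto simp: push_family_def)

text \<open>The closure criterion involves only inclusions and closures, which a homeomorphism
  preserves and reflects. Injectivity then follows by antisymmetry.\<close>

lemma homeomorphic_map_imp_order_isomorphism: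
  assumes X: "completely_regular_space X" and Y: "completely_regular_space Y"
    and f: "homeomorphic_map X Y f"
    and \<phi>: "\<And>\<alpha>. \<alpha> \<in> directed_families X \<Longrightarrow> \<phi> (C_top X \<alpha>) = C_top Y (push_family f \<alpha>)"
  shows "order_isomorphism (C_topologies X) coarser (C_topologies Y) coarser \<phi>"
proof -
  have surj: "f ` topspace X = topspace Y" and inj: "inj_on f (topspace X)"
    using f by (auto simp: homeomorphic_eq_everything_map)
  have pf: "push_family f \<alpha> \<in> directed_families Y" if "\<alpha> \<in> directed_families X" for \<alpha>
    using that surj by (intro push_family_directed) auto
  have sub: "f ` A \<subseteq> Y closure_of (f ` B) \<longleftrightarrow> A \<subseteq> X closure_of B"
    if "A \<subseteq> topspace X" "B \<subseteq> topspace X" for A B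
    using that homeomorphic_map_closure_of[OF f that(2)] inj
      inj_on_image_subset_iff[OF inj that(1) closure_of_subset_topspace] by simp
  have mono: "coarser (\<phi> S) (\<phi> T) \<longleftrightarrow> coarser S T"
    if ST: "S \<in> C_topologies X" "T \<in> C_topologies X" for S T
  proof -
    obtain \<alpha> \<beta> where ab: "\<alpha> \<in> directed_families X" "\<beta> \<in> directed_families X"
        and S: "S = C_top X \<alpha>" and T: "T = C_top X \<beta>"
      using ST by (auto simp: C_topologies_def)
    have "coarser (\<phi> S) (\<phi> T) \<longleftrightarrow> (\<forall>A\<in>\<alpha>. \<exists>B\<in>\<beta>. f ` A \<subseteq> Y closure_of (f ` B))"
      unfolding S T \<phi>[OF ab(1)] \<phi>[OF ab(2)] coarser_C_top_iff[OF Y pf[OF ab(1)] pf[OF ab(2)]]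
      by (simp add: push_family_eq_image)
    also have "\<dots> \<longleftrightarrow> coarser S T"
      unfolding S T coarser_C_top_iff[OF X ab]
      using sub directed_familiesD[OF ab(1)] directed_familiesD[OF ab(2)]
      by (intro ball_cong bex_cong) auto
    finally show ?thesis .
  qed
  have "inj_on \<phi> (C_topologies X)"
    by (intro inj_onI coarser_antisym) (metis mono coarser_refl)+
  moreover have "\<phi> ` C_topologies X = C_topologies Y"
  proof
    show "\<phi> ` C_topologies X \<subseteq> C_topologies Y"
      using \<phi> pf by (auto simp: C_topologies_def)
    show "C_topologies Y \<subseteq> \<phi> ` C_topologies X"
    proof
      fix T assume "T \<in> C_topologies Y"
      then obtain \<beta> where \<beta>: "\<beta> \<in> directed_families Y" "T = C_top Y \<beta>"
        by (auto simp: C_topologies_def)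
      \<comment> \<open>Pushing \<open>\<beta>\<close> back along the inverse of \<open>f\<close>
        gives a family whose image under \<open>f\<close> is exactly \<open>\<beta>\<close>.\<close>
      define k where "k = inv_into (topspace X) f"
      have k: "push_family k \<beta> \<in> directed_families X"
        using \<beta>(1) surj by (intro push_family_directed) (auto simp: k_def inv_into_into)
      have "f ` k ` B = B" if "B \<in> \<beta>" for B
        unfolding k_def using image_inv_into_cancel[OF surj directed_familiesD[OF \<beta>(1) that]] .
      then have "push_family f (push_family k \<beta>) = \<beta>"
        by (simp add: push_family_eq_image image_image)
      then have "T = \<phi> (C_top X (push_family k \<beta>))" using \<phi>[OF k] \<beta>(2) by simp
      then show "T \<in> \<phi> ` C_topologies X" using k C_top_in_C_topologies by blast
    qed
  qed
  ultimately show ?thesis using mono by (simp add: order_isomorphism_def bij_betw_def)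
qed

theorem corollary3p17:
  fixes X :: "'a topology" and Y :: "'b topology"
    and \<phi> :: "('a \<Rightarrow> real) topology \<Rightarrow> ('b \<Rightarrow> real) topology"
  assumes "zero_dimensional_space X" and "tychonoff_space X"
    and "zero_dimensional_space Y" and "tychonoff_space Y"
    and "\<phi> \<in> C_topologies X \<rightarrow> C_topologies Y"
  shows "order_isomorphism (C_topologies X) coarser (C_topologies Y) coarser \<phi>
     \<longleftrightarrow> (\<exists>f. homeomorphic_map X Y f \<and>
           {(S, \<phi> S) | S. S \<in> C_topologies X} =
           {(C_top X \<alpha>, C_top Y (push_family f \<alpha>)) | \<alpha>. \<alpha> \<in> directed_families X})"
proof -
  have X: "completely_regular_space X" "t1_space X"
    and Y: "completely_regular_space Y" "t1_space Y"
    using assms by (auto simp: tychonoff_space_def Hausdorff_imp_t1_space)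
  \<comment> \<open>Equality with the graph of \<open>\<phi>\<close> becomes an equation for every
    representing family \<open>\<alpha>\<close>, so independence of the choice of
    \<open>\<alpha>\<close> is included.\<close>
  have graph: "{(S, \<phi> S) | S. S \<in> C_topologies X} =
           {(C_top X \<alpha>, C_top Y (push_family f \<alpha>)) | \<alpha>. \<alpha> \<in> directed_families X}
      \<longleftrightarrow> (\<forall>\<alpha>\<in>directed_families X. \<phi> (C_top X \<alpha>) = C_top Y (push_family f \<alpha>))"
    (is "?L = ?R \<longleftrightarrow> _") for f
  proof
    assume eq: "?L = ?R"
    show "\<forall>\<alpha>\<in>directed_families X. \<phi> (C_top X \<alpha>) = C_top Y (push_family f \<alpha>)"
    proof
      fix \<alpha> assume "\<alpha> \<in> directed_families X"
      then have "(C_top X \<alpha>, C_top Y (push_family f \<alpha>)) \<in> ?L" unfolding eq by blast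
      then show "\<phi> (C_top X \<alpha>) = C_top Y (push_family f \<alpha>)" by auto
    qed
  next
    assume "\<forall>\<alpha>\<in>directed_families X. \<phi> (C_top X \<alpha>) = C_top Y (push_family f \<alpha>)"
    moreover have "?L = (\<lambda>\<alpha>. (C_top X \<alpha>, \<phi> (C_top X \<alpha>))) ` directed_families X"
      by (auto simp: C_topologies_def)
    moreover have "?R = (\<lambda>\<alpha>. (C_top X \<alpha>, C_top Y (push_family f \<alpha>))) ` directed_families X"
      by blast
    ultimately show "?L = ?R" by (metis (no_types, lifting) image_cong)
  qed
  show ?thesis
    unfolding graph
    using order_isomorphism_imp_homeomorphic_map[OF X Y]
      homeomorphic_map_imp_order_isomorphism[OF X(1) Y(1)] by metis
qed

end
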